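(* Let $(\mathbb{R}^n,g_0)$ be the Euclidean space, $n\ge3$, with coordinates $x=(x_1,\dots,x_n)$ and $(g_0)_{ij}=\delta_{ij}$, $1\le i,j\le n$. Let $r=\sum_{k=1}^nx_k^2$ and, for $A,k_2\in\mathbb{R}$ with $k_2>0$, consider the metric $\bar g=\frac{1}{\psi(r)^2}g_0$ with $$\psi(r)=\frac{k_2\,r}{\left(1+Ar^{\frac{n-2}{2}}\right)^{\frac{2}{n-2}}}.$$ Then $\bar g$, as a metric on $\mathbb{R}^n\setminus\{0\}$, is complete whenever $A>0$. *)

theory Defs
  imports "HOL-Analysis.Analysis"
begin

text \<open>A metric tensor on an open subset of \<open>\<real>\<^sup>n\<close> assigns to each point the bilinear form \<open>(v, w) \<mapsto> g x v w\<close>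
  on the tangent space, which is identified with \<open>\<real>\<^sup>n\<close> through the global coordinates.\<close>

type_synonym 'n metric_tensor = "real^'n \<Rightarrow> real^'n \<Rightarrow> real^'n \<Rightarrow> real"

text \<open>\<^const>\<open>inner\<close> on \<^typ>\<open>real^'n\<close> is \<open>\<Sum>i. v $ i * w $ i\<close>, so \<open>(g\<^sub>0)\<^sub>i\<^sub>j = \<delta>\<^sub>i\<^sub>j\<close>.\<close>

definition flat_metric :: "'n::finite metric_tensor" where
  "flat_metric x v w = inner v w"

definition conformal_metric ::
  "(real^'n \<Rightarrow> real) \<Rightarrow> 'n::finite metric_tensor \<Rightarrow> 'n metric_tensor" where
  "conformal_metric \<phi> g x v w = 1 / (\<phi> x)\<^sup>2 * g x v w"

text \<open>The length takes values in \<^typ>\<open>ennreal\<close>: the derivative of a \<^const>\<open>valid_path\<close> (continuous,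
  and continuously differentiable off a finite set) may be unbounded near an exceptional parameter,
  so the length may be infinite. The exceptional parameters form a null set.\<close>

definition riemannian_length :: "'n::finite metric_tensor \<Rightarrow> (real \<Rightarrow> real^'n) \<Rightarrow> ennreal" where
  "riemannian_length g \<gamma> =
     (\<integral>\<^sup>+ t \<in> {0..1}. ennreal (sqrt (g (\<gamma> t) (vector_derivative \<gamma> (at t)) (vector_derivative \<gamma> (at t))))
        \<partial>lborel)"

text \<open>Meant for connected open \<open>U\<close>. For points not joined by a path of finite length in \<open>U\<close> the infimum
  is \<open>\<infinity>\<close> and \<^const>\<open>enn2real\<close> returns \<open>0\<close>, so that for distinct points of \<open>U\<close> the
  metric axioms required in \<open>complete_riemannian\<close> below fail.\<close>

definition riemannian_dist ::
  "(real^'n) set \<Rightarrow> 'n::finite metric_tensor \<Rightarrow> real^'n \<Rightarrow> real^'n \<Rightarrow> real" where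
  "riemannian_dist U g x y =
     enn2real (INF \<gamma> \<in> {\<gamma>. valid_path \<gamma> \<and> path_image \<gamma> \<subseteq> U \<and> pathstart \<gamma> = x \<and> pathfinish \<gamma> = y}.
       riemannian_length g \<gamma>)"

text \<open>Completeness of \<open>(U, g)\<close> is completeness of the associated metric space \<open>(U, d\<^sub>g)\<close>.\<close>

definition complete_riemannian :: "(real^'n) set \<Rightarrow> 'n::finite metric_tensor \<Rightarrow> bool" where
  "complete_riemannian U g \<longleftrightarrow>
     Metric_space U (riemannian_dist U g) \<and> Metric_space.mcomplete U (riemannian_dist U g)"

definition psi :: "nat \<Rightarrow> real \<Rightarrow> real \<Rightarrow> real \<Rightarrow> real" where
  "psi n A k2 r =
     k2 * r / (1 + A * r powr ((real n - 2) / 2)) powr (2 / (real n - 2))"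

text \<open>Here \<open>r\<close> is the square of the Euclidean norm.\<close>

definition r_of :: "real^'n::finite \<Rightarrow> real" where
  "r_of x = (\<Sum>k\<in>UNIV. (x $ k)\<^sup>2)"

end

theory Submission
  imports Defs
begin

text \<open>Since \<open>1 / \<psi>(r) = (r\<^bsup>-m\<^esup> + A)\<^bsup>1/m\<^esup> / k\<^sub>2\<close> with \<open>m = (n - 2) / 2\<close>, the factor \<open>1 / \<psi>\<close> is at
  least \<open>A\<^bsup>1/m\<^esup> / k\<^sub>2\<close> and at least \<open>1 / (k\<^sub>2 r)\<close>. By the first bound a Cauchy sequence of the
  Riemannian distance is Euclidean Cauchy. By the second bound \<open>x \<mapsto> 1 / (k\<^sub>2 \<bar>x\<bar>)\<close> is
  1-Lipschitz for the Riemannian distance, so such a sequence stays away from the origin.\<close>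

section \<open>Speed and length of paths in a conformally flat metric\<close>

definition conf_speed :: "(real^'n::finite \<Rightarrow> real) \<Rightarrow> (real \<Rightarrow> real^'n) \<Rightarrow> real \<Rightarrow> real" where
  "conf_speed \<phi> \<gamma> t = norm (vector_derivative \<gamma> (at t)) / \<bar>\<phi> (\<gamma> t)\<bar>"

lemma conf_speed_nonneg [simp]: "0 \<le> conf_speed \<phi> \<gamma> t"
  by (simp add: conf_speed_def)

text \<open>Because sqrt(|v|^2 / a^2) = |v| / |a|, with both sides 0 when a = 0. The indicator is
  placed inside \<open>ennreal\<close> so that measurability and integrability can be treated for a
  real-valued integrand.\<close>

lemma riemannian_length_conformal:
  "riemannian_length (conformal_metric \<phi> flat_metric) \<gamma> =
     (\<integral>\<^sup>+t. ennreal (indicator {0..1} t * conf_speed \<phi> \<gamma> t) \<partial>lborel)"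
proof -
  have *: "sqrt (1 / a\<^sup>2 * inner v v) = norm v / \<bar>a\<bar>" for a and v :: "real^'n"
    by (simp add: real_sqrt_mult real_sqrt_divide norm_eq_sqrt_inner)
  show ?thesis
    unfolding riemannian_length_def conformal_metric_def flat_metric_def * conf_speed_def
    by (intro nn_integral_cong) (auto simp: indicator_def)
qed

lemma valid_path_vector_derivative:
  assumes "valid_path \<gamma>"
  obtains S where "finite S"
    and "\<And>t. t \<in> {0..1} - S \<Longrightarrow> (\<gamma> has_vector_derivative vector_derivative \<gamma> (at t)) (at t)"
    and "continuous_on ({0..1} - S) (\<lambda>t. vector_derivative \<gamma> (at t))"
  using assms vector_derivative_works
  unfolding valid_path_def piecewise_C1_differentiable_on_def C1_differentiable_on_eq by blast

lemma valid_path_polynomial_function: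
  fixes p :: "real \<Rightarrow> 'a::euclidean_space"
  assumes "polynomial_function p"
  shows "valid_path p"
proof -
  obtain p' where "polynomial_function p'" "\<And>x. (p has_vector_derivative p' x) (at x)"
    using has_vector_derivative_polynomial_function [OF assms] by blast
  then show ?thesis
    unfolding valid_path_def
    by (intro C1_differentiable_imp_piecewise)
      (auto simp: C1_differentiable_on_def intro!: exI [of _ p'] continuous_on_polymonial_function)
qed

text \<open>The bound \<open>B\<close> keeps the scale 1 / \<open>\<phi>\<close> above 1 /
  \<open>B\<close>, so the Riemannian distance dominates a multiple of the Euclidean one. Openness
  and connectedness supply joining paths of finite length.\<close>

locale conformally_flat =
  fixes U :: "(real^'n::finite) set" and \<phi> :: "real^'n \<Rightarrow> real" and B :: real
  assumes open_U: "open U" and connected_U: "connected U"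
    and continuous_factor: "continuous_on U \<phi>"
    and factor_pos: "x \<in> U \<Longrightarrow> 0 < \<phi> x"
    and factor_le: "x \<in> U \<Longrightarrow> \<phi> x \<le> B"
begin

abbreviation len :: "(real \<Rightarrow> real^'n) \<Rightarrow> ennreal" where
  "len \<equiv> riemannian_length (conformal_metric \<phi> flat_metric)"

abbreviation dst :: "real^'n \<Rightarrow> real^'n \<Rightarrow> real" where
  "dst \<equiv> riemannian_dist U (conformal_metric \<phi> flat_metric)"

definition paths :: "real^'n \<Rightarrow> real^'n \<Rightarrow> (real \<Rightarrow> real^'n) set" where
  "paths x y = {\<gamma>. valid_path \<gamma> \<and> path_image \<gamma> \<subseteq> U \<and> pathstart \<gamma> = x \<and> pathfinish \<gamma> = y}"

lemma dst_eq: "dst x y = enn2real (INF \<gamma>\<in>paths x y. len \<gamma>)"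
  by (simp add: riemannian_dist_def paths_def)

lemma dst_nonneg: "0 \<le> dst x y"
  by (simp add: dst_eq)

section \<open>Lengths of paths: measurability, reversal, concatenation, lower bounds,
  finiteness\<close>

lemma continuous_on_factor_path:
  assumes "valid_path \<gamma>" "path_image \<gamma> \<subseteq> U"
  shows "continuous_on {0..1} (\<lambda>t. \<phi> (\<gamma> t))"
  using assms continuous_on_compose2 [OF continuous_factor, of "{0..1}" \<gamma>] valid_path_imp_path
  by (auto simp: path_def path_image_def)

text \<open>Off the finite exceptional set the speed is continuous, and altering a function on a
  countable set preserves measurability. The changes of variable below depend on this.\<close>

lemma conf_speed_measurable:
  assumes "valid_path \<gamma>" "path_image \<gamma> \<subseteq> U"
  shows "(\<lambda>t. indicator {0..1} t * conf_speed \<phi> \<gamma> t) \<in> borel_measurable borel"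
proof -
  obtain S where S: "finite S" "continuous_on ({0..1} - S) (\<lambda>t. vector_derivative \<gamma> (at t))"
    using valid_path_vector_derivative [OF assms(1)] by metis
  have "\<phi> (\<gamma> t) \<noteq> 0" if "t \<in> {0..1}" for t
    using factor_pos [of "\<gamma> t"] assms(2) that by (force simp: path_image_def image_subset_iff)
  then have "continuous_on ({0..1} - S) (conf_speed \<phi> \<gamma>)"
    unfolding conf_speed_def
    by (intro continuous_intros S(2) continuous_on_subset [OF continuous_on_factor_path [OF assms]]) auto
  then have "(\<lambda>t. indicator ({0..1} - S) t *\<^sub>R conf_speed \<phi> \<gamma> t) \<in> borel_measurable borel"
    using S(1) by (intro borel_measurable_continuous_on_indicator) (auto intro: finite_imp_closed borel_closed)
  then show ?thesis
    by (rule measurable_discrete_difference [where X = S])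
      (use S(1) in \<open>auto simp: countable_finite indicator_def\<close>)
qed

lemma len_le:
  assumes "\<And>t. t \<in> {0..1} \<Longrightarrow> conf_speed \<phi> \<gamma> t \<le> M"
  shows "len \<gamma> \<le> ennreal M"
proof -
  have "len \<gamma> \<le> (\<integral>\<^sup>+t. ennreal M * indicator {0..1::real} t \<partial>lborel)"
    unfolding riemannian_length_conformal
    by (intro nn_integral_mono) (auto simp: indicator_def assms ennreal_leI)
  also have "\<dots> = ennreal M"
    by (simp add: nn_integral_cmult_indicator)
  finally show ?thesis .
qed

text \<open>Substitution of 1 - t for t. The speeds correspond except on the reflected exceptional
  set, which is a null set.\<close>

lemma len_reversepath:
  assumes "valid_path \<gamma>" "path_image \<gamma> \<subseteq> U"
  shows "len (reversepath \<gamma>) = len \<gamma>"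
proof -
  obtain S where S: "finite S"
    "\<And>t. t \<in> {0..1} - S \<Longrightarrow> (\<gamma> has_vector_derivative vector_derivative \<gamma> (at t)) (at t)"
    using valid_path_vector_derivative [OF assms(1)] by metis
  have speed: "conf_speed \<phi> (reversepath \<gamma>) t = conf_speed \<phi> \<gamma> (1 - t)"
    if "t \<in> {0..1} - (-) 1 ` S" for t
  proof -
    have "1 - t \<in> {0..1} - S"
      using that by (auto intro: rev_image_eqI [of "1 - t"])
    then have "(\<gamma> has_vector_derivative vector_derivative \<gamma> (at (1 - t))) (at (1 - t))"
      by (rule S(2))
    moreover have "((-) 1 has_vector_derivative -1) (at t)"
      by (auto intro!: derivative_eq_intros)
    ultimately have "(reversepath \<gamma> has_vector_derivative (-1) *\<^sub>R vector_derivative \<gamma> (at (1 - t))) (at t)"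
      unfolding reversepath_def
      using vector_diff_chain_at [of "(-) 1" "-1" t \<gamma>] by (simp add: o_def)
    then have "vector_derivative (reversepath \<gamma>) (at t) = - vector_derivative \<gamma> (at (1 - t))"
      by (simp add: vector_derivative_at)
    then show ?thesis
      by (simp add: conf_speed_def reversepath_def)
  qed
  have "len \<gamma> = (\<integral>\<^sup>+t. ennreal (indicator {0..1} (1 - t) * conf_speed \<phi> \<gamma> (1 - t)) \<partial>lborel)"
    unfolding riemannian_length_conformal
    using conf_speed_measurable [OF assms]
    by (subst nn_integral_real_affine [where c = "-1" and t = 1]) auto
  also have "\<dots> = len (reversepath \<gamma>)"
    unfolding riemannian_length_conformal
  proof (intro nn_integral_cong_AE)
    have "AE t in lborel. t \<notin> (-) 1 ` S"
      using S(1) by (intro AE_not_in finite_imp_null_set_lborel) auto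
    then show "AE t in lborel. ennreal (indicator {0..1} (1 - t) * conf_speed \<phi> \<gamma> (1 - t)) =
        ennreal (indicator {0..1} t * conf_speed \<phi> (reversepath \<gamma>) t)"
      by eventually_elim (auto simp: indicator_def speed)
  qed
  finally show ?thesis ..
qed

text \<open>Each half of the joined path runs at twice the original speed, and this factor 2 is the
  one produced by the affine substitution on that half.\<close>

lemma len_joinpaths:
  assumes "valid_path \<gamma>" "path_image \<gamma> \<subseteq> U" "valid_path \<eta>" "path_image \<eta> \<subseteq> U"
  shows "len (\<gamma> +++ \<eta>) = len \<gamma> + len \<eta>"
proof -
  obtain S where S: "finite S"
    "\<And>t. t \<in> {0..1} - S \<Longrightarrow> (\<gamma> has_vector_derivative vector_derivative \<gamma> (at t)) (at t)"
    using valid_path_vector_derivative [OF assms(1)] by metis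
  obtain T where T: "finite T"
    "\<And>t. t \<in> {0..1} - T \<Longrightarrow> (\<eta> has_vector_derivative vector_derivative \<eta> (at t)) (at t)"
    using valid_path_vector_derivative [OF assms(3)] by metis
  \<comment> \<open>The exceptional parameters of both halves, carried to the joined
    parametrisation, together with the junction 1/2, where the path may have a corner.\<close>
  define N where "N = insert (1/2) ((\<lambda>s. s / 2) ` S \<union> (\<lambda>s. (s + 1) / 2) ` T)"
  let ?f = "\<lambda>t. indicator {0..1} t * conf_speed \<phi> \<gamma> t"
  let ?g = "\<lambda>t. indicator {0..1} t * conf_speed \<phi> \<eta> t"
  have [measurable]: "?f \<in> borel_measurable borel" "?g \<in> borel_measurable borel"
    by (simp_all add: conf_speed_measurable assms)
  have speed1: "conf_speed \<phi> (\<gamma> +++ \<eta>) t = 2 * conf_speed \<phi> \<gamma> (2 * t)"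
    if "0 \<le> t" "t < 1/2" "t \<notin> N" for t
  proof -
    have "2 * t \<notin> S"
      using that by (auto simp: N_def image_iff mult.commute)
    then have "(\<gamma> has_vector_derivative vector_derivative \<gamma> (at (2 * t))) (at (2 * t))"
      using that by (intro S(2)) auto
    moreover have "((*) 2 has_vector_derivative 2) (at t)"
      by (auto intro!: derivative_eq_intros)
    ultimately have "((\<lambda>t. \<gamma> (2 * t)) has_vector_derivative 2 *\<^sub>R vector_derivative \<gamma> (at (2 * t))) (at t)"
      using vector_diff_chain_at [of "(*) 2" 2 t \<gamma>] by (simp add: o_def)
    then have "(\<gamma> +++ \<eta> has_vector_derivative 2 *\<^sub>R vector_derivative \<gamma> (at (2 * t))) (at t)"
      by (rule has_vector_derivative_transform_within_open [of _ _ _ "{..<1/2}"])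
        (use that in \<open>auto simp: joinpaths_def\<close>)
    then show ?thesis
      using that by (simp add: conf_speed_def vector_derivative_at joinpaths_def)
  qed
  have speed2: "conf_speed \<phi> (\<gamma> +++ \<eta>) t = 2 * conf_speed \<phi> \<eta> (2 * t - 1)"
    if "1/2 < t" "t \<le> 1" "t \<notin> N" for t
  proof -
    have "2 * t - 1 \<notin> T"
      using that by (auto simp: N_def image_iff dest!: bspec)
    then have "(\<eta> has_vector_derivative vector_derivative \<eta> (at (2 * t - 1))) (at (2 * t - 1))"
      using that by (intro T(2)) auto
    moreover have "((\<lambda>t. 2 * t - 1) has_vector_derivative 2) (at t)"
      by (auto intro!: derivative_eq_intros)
    ultimately have "((\<lambda>t. \<eta> (2 * t - 1)) has_vector_derivative
        2 *\<^sub>R vector_derivative \<eta> (at (2 * t - 1))) (at t)"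
      using vector_diff_chain_at [of "\<lambda>t. 2 * t - 1" 2 t \<eta>] by (simp add: o_def)
    then have "(\<gamma> +++ \<eta> has_vector_derivative 2 *\<^sub>R vector_derivative \<eta> (at (2 * t - 1))) (at t)"
      by (rule has_vector_derivative_transform_within_open [of _ _ _ "{1/2<..}"])
        (use that in \<open>auto simp: joinpaths_def\<close>)
    then show ?thesis
      using that by (simp add: conf_speed_def vector_derivative_at joinpaths_def)
  qed
  \<comment> \<open>After the substitutions the two integrands live on [0, 1/2] and [1/2, 1]; they
    overlap only at 1/2, which lies in \<open>N\<close>.\<close>
  have "len \<gamma> = 2 * (\<integral>\<^sup>+t. ennreal (?f (0 + 2 * t)) \<partial>lborel)"
    unfolding riemannian_length_conformal
    by (subst nn_integral_real_affine [where c = 2 and t = 0]) auto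
  moreover have "len \<eta> = 2 * (\<integral>\<^sup>+t. ennreal (?g (-1 + 2 * t)) \<partial>lborel)"
    unfolding riemannian_length_conformal
    by (subst nn_integral_real_affine [where c = 2 and t = "-1"]) auto
  ultimately have "len \<gamma> + len \<eta> =
      (\<integral>\<^sup>+t. 2 * ennreal (?f (0 + 2 * t)) + 2 * ennreal (?g (-1 + 2 * t)) \<partial>lborel)"
    by (subst nn_integral_add) (auto simp: nn_integral_cmult)
  also have "\<dots> = len (\<gamma> +++ \<eta>)"
    unfolding riemannian_length_conformal
  proof (intro nn_integral_cong_AE)
    have "AE t in lborel. t \<notin> N"
      using S(1) T(1) by (intro AE_not_in finite_imp_null_set_lborel) (auto simp: N_def)
    then show "AE t in lborel. 2 * ennreal (?f (0 + 2 * t)) + 2 * ennreal (?g (-1 + 2 * t)) =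
        ennreal (indicator {0..1} t * conf_speed \<phi> (\<gamma> +++ \<eta>) t)"
    proof eventually_elim
      case (elim t)
      then have "t \<noteq> 1/2"
        by (auto simp: N_def)
      then consider "t < 0" | "0 \<le> t" "t < 1/2" | "1/2 < t" "t \<le> 1" | "1 < t"
        by linarith
      then show ?case
        by cases (use elim in \<open>auto simp: indicator_def speed1 speed2 ennreal_mult\<close>)
    qed
  qed
  finally show ?thesis ..
qed

text \<open>By the chain rule, \<open>f\<close> along the path moves no faster than the conformal
  speed, and integration gives the bound. For infinite length there is nothing to prove.\<close>

lemma len_ge:
  fixes f :: "real^'n \<Rightarrow> 'b::euclidean_space"
  assumes f: "\<And>x. x \<in> U \<Longrightarrow> (f has_derivative f' x) (at x)"
    and bound: "\<And>x v. x \<in> U \<Longrightarrow> norm (f' x v) \<le> norm v / \<phi> x"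
    and \<gamma>: "\<gamma> \<in> paths x y"
  shows "ennreal (norm (f y - f x)) \<le> len \<gamma>"
proof (cases "len \<gamma>")
  case (real l)
  have vp: "valid_path \<gamma>" and im: "path_image \<gamma> \<subseteq> U" and ends: "\<gamma> 0 = x" "\<gamma> 1 = y"
    using \<gamma> by (auto simp: paths_def pathstart_def pathfinish_def)
  have in_U: "\<gamma> t \<in> U" if "t \<in> {0..1}" for t
    using im that by (auto simp: path_image_def)
  obtain S where S: "finite S"
    "\<And>t. t \<in> {0..1} - S \<Longrightarrow> (\<gamma> has_vector_derivative vector_derivative \<gamma> (at t)) (at t)"
    using valid_path_vector_derivative [OF vp] by metis
  let ?h = "\<lambda>t. indicator {0..1} t * conf_speed \<phi> \<gamma> t"
  \<comment> \<open>Finite length turns the nonnegative Lebesgue integral into a gauge integral, the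
    form in which the fundamental theorem of calculus is applied.\<close>
  have "(?h has_integral l) UNIV"
    using conf_speed_measurable [OF vp im] real
    by (intro nn_integral_has_integral) (auto simp: riemannian_length_conformal)
  then have h: "(conf_speed \<phi> \<gamma> has_integral l) {0..1}"
    by (subst has_integral_restrict_UNIV [symmetric])
      (auto simp: indicator_def elim: has_integral_eq [rotated])
  define D where "D t = (if t \<in> S then 0 else f' (\<gamma> t) (vector_derivative \<gamma> (at t)))" for t
  have "(f \<circ> \<gamma> has_vector_derivative D t) (at t)" if "t \<in> {0<..<1} - S" for t
    using vector_derivative_diff_chain_within [of \<gamma> _ t UNIV f] S(2) [of t] f [OF in_U [of t]] that
    by (auto simp: D_def intro: has_derivative_at_withinI)
  \<comment> \<open>Continuity on the whole interval lets the fundamental theorem tolerate the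
    finite set \<open>S\<close>.\<close>
  moreover have "continuous_on U f"
    using f by (intro continuous_at_imp_continuous_on ballI has_derivative_continuous)
  then have "continuous_on {0..1} (f \<circ> \<gamma>)"
    using valid_path_imp_path [OF vp] im
    by (intro continuous_on_compose) (simp_all add: path_def path_image_def continuous_on_subset)
  ultimately have D: "(D has_integral (f y - f x)) {0..1}"
    using fundamental_theorem_of_calculus_interior_strong [OF S(1), of 0 1 "f \<circ> \<gamma>" D] ends by simp
  have "norm (D t) \<le> conf_speed \<phi> \<gamma> t" if "t \<in> {0..1}" for t
    using bound [OF in_U [OF that]] factor_pos [OF in_U [OF that]] by (simp add: D_def conf_speed_def)
  then have "norm (integral {0..1} D) \<le> integral {0..1} (conf_speed \<phi> \<gamma>)"
    using D h by (intro integral_norm_bound_integral) auto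
  then show ?thesis
    using D h real by (simp add: integral_unique ennreal_leI)
qed simp

text \<open>A polynomial path has a continuous derivative on the whole compact interval, so its
  speed is bounded. An arbitrary \<open>valid_path\<close> could have unbounded speed near an
  exceptional parameter.\<close>

lemma exists_path_finite_len:
  assumes "x \<in> U" "y \<in> U"
  obtains \<gamma> where "\<gamma> \<in> paths x y" "len \<gamma> < \<infinity>"
proof -
  obtain p where p: "polynomial_function p" "path_image p \<subseteq> U" "pathstart p = x" "pathfinish p = y"
    using connected_open_polynomial_connected [OF open_U connected_U assms] by blast
  obtain p' where p': "polynomial_function p'" "\<And>t. (p has_vector_derivative p' t) (at t)"
    using has_vector_derivative_polynomial_function [OF p(1)] by blast
  have vp: "valid_path p"
    by (rule valid_path_polynomial_function [OF p(1)])
  have "\<phi> (p t) \<noteq> 0" if "t \<in> {0..1}" for t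
    using factor_pos [of "p t"] p(2) that by (force simp: path_image_def image_subset_iff)
  then have "continuous_on {0..1} (conf_speed \<phi> p)"
    unfolding conf_speed_def vector_derivative_at [OF p'(2)]
    by (intro continuous_intros continuous_on_factor_path [OF vp p(2)]
        continuous_on_polymonial_function p'(1)) auto
  then have "bounded (conf_speed \<phi> p ` {0..1})"
    by (intro compact_imp_bounded compact_continuous_image) auto
  then obtain M where "\<And>t. t \<in> {0..1} \<Longrightarrow> conf_speed \<phi> p t \<le> M"
    unfolding bounded_iff by fastforce
  then have "len p \<le> ennreal M"
    by (rule len_le)
  also have "\<dots> < \<infinity>"
    by simp
  finally show ?thesis
    using that vp p by (auto simp: paths_def)
qed

text \<open>Holds because the infimum is finite: \<open>enn2real\<close> sends infinity to the
  default value 0, and a path of finite length excludes that case.\<close>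

lemma ennreal_dst:
  assumes "x \<in> U" "y \<in> U"
  shows "ennreal (dst x y) = (INF \<gamma>\<in>paths x y. len \<gamma>)"
proof -
  obtain \<gamma> where "\<gamma> \<in> paths x y" "len \<gamma> < \<infinity>"
    using exists_path_finite_len [OF assms] .
  then have "(INF \<gamma>\<in>paths x y. len \<gamma>) < top"
    by (auto intro: INF_lower le_less_trans)
  then show ?thesis
    by (simp add: dst_eq)
qed

section \<open>Comparison estimates for the distance\<close>

lemma dst_ge:
  fixes f :: "real^'n \<Rightarrow> 'b::euclidean_space"
  assumes "\<And>x. x \<in> U \<Longrightarrow> (f has_derivative f' x) (at x)"
    and "\<And>x v. x \<in> U \<Longrightarrow> norm (f' x v) \<le> norm v / \<phi> x"
    and "x \<in> U" "y \<in> U"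
  shows "norm (f y - f x) \<le> dst x y"
proof -
  have "ennreal (norm (f y - f x)) \<le> ennreal (dst x y)"
    unfolding ennreal_dst [OF assms(3,4)] using len_ge [OF assms(1,2)] by (intro INF_greatest)
  then show ?thesis
    by (simp add: dst_nonneg)
qed

text \<open>Apply \<open>dst_ge\<close> to the scaled identity x / \<open>B\<close>, whose
  derivative has norm 1 / \<open>B\<close> \<le> 1 / \<open>\<phi>\<close>.\<close>

lemma dst_ge_euclidean:
  assumes "x \<in> U" "y \<in> U"
  shows "dist x y \<le> B * dst x y"
proof -
  have B: "0 < B"
    using factor_pos factor_le assms(1) by fastforce
  have "norm ((1 / B) *\<^sub>R y - (1 / B) *\<^sub>R x) \<le> dst x y"
  proof (rule dst_ge [where f' = "\<lambda>x v. (1 / B) *\<^sub>R v"])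
    show "((\<lambda>x. (1 / B) *\<^sub>R x) has_derivative (*\<^sub>R) (1 / B)) (at x)" for x :: "real^'n"
      by (auto intro!: derivative_eq_intros)
    show "norm ((1 / B) *\<^sub>R v) \<le> norm v / \<phi> x" if "x \<in> U" for x v
      using factor_pos factor_le that B by (auto intro!: divide_left_mono)
  qed (use assms in auto)
  moreover have "norm ((1 / B) *\<^sub>R y - (1 / B) *\<^sub>R x) = dist x y / B"
    using B by (simp add: scaleR_diff_right [symmetric] dist_norm norm_minus_commute)
  ultimately show ?thesis
    using B by (simp add: field_simps)
qed

text \<open>The straight path has constant Euclidean speed \<open>dist x y\<close>, scaled by at
  most \<open>M\<close>. This gives the local converse to \<open>dst_ge_euclidean\<close>, and for
  equal endpoints the vanishing of the distance.\<close>

lemma dst_le_segment: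
  assumes "closed_segment x y \<subseteq> U" "\<And>z. z \<in> closed_segment x y \<Longrightarrow> 1 / \<phi> z \<le> M"
  shows "dst x y \<le> M * dist x y"
proof -
  have xy: "x \<in> U" "y \<in> U"
    using assms(1) by auto
  have "0 < \<phi> x" "1 / \<phi> x \<le> M"
    using assms(2) xy factor_pos by auto
  then have M: "0 \<le> M"
    by (smt (verit) divide_nonneg_pos)
  have "conf_speed \<phi> (linepath x y) t \<le> M * dist x y" if "t \<in> {0..1}" for t
  proof -
    have z: "linepath x y t \<in> closed_segment x y"
      using that by (auto simp: linepath_in_path)
    then have "\<phi> (linepath x y t) > 0"
      using assms(1) factor_pos by auto
    then have "conf_speed \<phi> (linepath x y) t = 1 / \<phi> (linepath x y t) * dist x y"
      by (simp add: conf_speed_def dist_norm norm_minus_commute)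
    then show ?thesis
      using assms(2) [OF z] by (simp add: mult_right_mono del: times_divide_eq_left)
  qed
  then have "len (linepath x y) \<le> ennreal (M * dist x y)"
    by (rule len_le)
  moreover have "linepath x y \<in> paths x y"
    using assms(1) by (simp add: paths_def)
  ultimately have "ennreal (dst x y) \<le> ennreal (M * dist x y)"
    unfolding ennreal_dst [OF xy] by (rule INF_lower2 [rotated])
  then show ?thesis
    using M by simp
qed

section \<open>The metric space axioms and a completeness criterion\<close>

sublocale Metric_space U dst
proof
  show "0 \<le> dst x y" for x y
    by (rule dst_nonneg)
  show "dst x y = dst y x" for x y
  proof -
    \<comment> \<open>One inequality for all pairs suffices, since exchanging the points gives the
      other.\<close>
    have "(INF \<gamma>\<in>paths y x. len \<gamma>) \<le> (INF \<gamma>\<in>paths x y. len \<gamma>)" for x y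
    proof (rule INF_mono)
      fix \<gamma> assume "\<gamma> \<in> paths x y"
      then show "\<exists>\<eta>\<in>paths y x. len \<eta> \<le> len \<gamma>"
        by (intro bexI [of _ "reversepath \<gamma>"]) (auto simp: paths_def len_reversepath)
    qed
    then show ?thesis
      unfolding dst_eq by (metis antisym)
  qed
  show "dst x y = 0 \<longleftrightarrow> x = y" if "x \<in> U" "y \<in> U" for x y
  proof
    show "dst x y = 0 \<Longrightarrow> x = y"
      using dst_ge_euclidean [OF that] by simp
    show "x = y \<Longrightarrow> dst x y = 0"
      using dst_le_segment [of x x "1 / \<phi> x"] that by (simp add: dst_nonneg antisym)
  qed
  show "dst x z \<le> dst x y + dst y z" if "x \<in> U" "y \<in> U" "z \<in> U" for x y z
  proof -
    have join: "ennreal (dst x z) \<le> len \<gamma> + len \<eta>" if "\<gamma> \<in> paths x y" "\<eta> \<in> paths y z" for \<gamma> \<eta>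
    proof -
      have "\<gamma> +++ \<eta> \<in> paths x z"
        using that by (auto simp: paths_def path_image_join intro: valid_path_join)
      moreover have "len (\<gamma> +++ \<eta>) = len \<gamma> + len \<eta>"
        using that by (auto simp: paths_def len_joinpaths)
      ultimately show ?thesis
        unfolding ennreal_dst [OF \<open>x \<in> U\<close> \<open>z \<in> U\<close>] by (metis INF_lower)
    qed
    \<comment> \<open>The two infima are taken one after the other, first over \<open>\<eta>\<close>
      with \<open>\<gamma>\<close> fixed. Moving a term across by \<open>ennreal\<close> subtraction
      is legitimate because \<open>ennreal (dst x z)\<close> is finite.\<close>
    have "ennreal (dst x z) - len \<gamma> \<le> ennreal (dst y z)" if "\<gamma> \<in> paths x y" for \<gamma>
      unfolding ennreal_dst [OF \<open>y \<in> U\<close> \<open>z \<in> U\<close>]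
      using join [OF that] by (intro INF_greatest) (simp add: ennreal_minus_le_iff)
    then have "ennreal (dst x z) - ennreal (dst y z) \<le> ennreal (dst x y)"
      unfolding ennreal_dst [OF \<open>x \<in> U\<close> \<open>y \<in> U\<close>]
      by (intro INF_greatest) (simp add: ennreal_minus_le_iff add.commute)
    then have "ennreal (dst x z) \<le> ennreal (dst x y + dst y z)"
      by (simp add: ennreal_minus_le_iff dst_nonneg add.commute)
    then show ?thesis
      by (simp add: dst_nonneg del: ennreal_plus)
  qed
qed

text \<open>A variant of Gordon's criterion: a function of bounded gradient that is proper towards the
  boundary of \<open>U\<close> forces completeness.\<close>

theorem complete_criterion:
  fixes f :: "real^'n \<Rightarrow> 'b::euclidean_space"
  assumes f: "\<And>x. x \<in> U \<Longrightarrow> (f has_derivative f' x) (at x)"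
    and bound: "\<And>x v. x \<in> U \<Longrightarrow> norm (f' x v) \<le> norm v / \<phi> x"
    and closed: "\<And>R. closed {x \<in> U. norm (f x) \<le> R}"
  shows "complete_riemannian U (conformal_metric \<phi> flat_metric)"
proof -
  have "\<exists>l. limitin mtopology \<sigma> l sequentially" if \<sigma>: "MCauchy \<sigma>" for \<sigma>
  proof -
    have in_U: "\<sigma> k \<in> U" for k
      using \<sigma> by (auto simp: MCauchy_def)
    have B: "0 < B"
      using factor_pos factor_le in_U [of 0] by fastforce
    \<comment> \<open>Euclidean completeness then yields a limit \<open>l\<close>, which at this
      stage may still lie on the boundary of \<open>U\<close>.\<close>
    have "Cauchy \<sigma>"
    proof (rule metric_CauchyI)
      fix e :: real assume "0 < e"
      then have "0 < e / B" using B by simp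
      then obtain N where N: "\<And>j k. N \<le> j \<Longrightarrow> N \<le> k \<Longrightarrow> dst (\<sigma> j) (\<sigma> k) < e / B"
        using \<sigma> unfolding MCauchy_def by blast
      have "dist (\<sigma> j) (\<sigma> k) < e" if "N \<le> j" "N \<le> k" for j k
        using dst_ge_euclidean [OF in_U [of j] in_U [of k]] N [OF that] B by (simp add: field_simps)
      then show "\<exists>N. \<forall>j\<ge>N. \<forall>k\<ge>N. dist (\<sigma> j) (\<sigma> k) < e"
        by blast
    qed
    then obtain l where l: "\<sigma> \<longlonglongrightarrow> l"
      using Cauchy_convergent convergent_def by blast
    obtain N where N: "\<And>j k. N \<le> j \<Longrightarrow> N \<le> k \<Longrightarrow> dst (\<sigma> j) (\<sigma> k) < 1"
      using \<sigma> unfolding MCauchy_def by (metis zero_less_one)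
    \<comment> \<open>\<open>f\<close> is 1-Lipschitz for the Riemannian distance, so it stays
      bounded along the tail. The sublevel set is closed in the whole space, so the limit cannot
      leave \<open>U\<close>.\<close>
    have "norm (f (\<sigma> k)) \<le> norm (f (\<sigma> N)) + 1" if "N \<le> k" for k
      using dst_ge [OF f bound in_U [of N] in_U [of k]] N [of N k] that
        norm_triangle_sub [of "f (\<sigma> k)" "f (\<sigma> N)"] by simp
    then have "\<forall>\<^sub>F k in sequentially. \<sigma> k \<in> {x \<in> U. norm (f x) \<le> norm (f (\<sigma> N)) + 1}"
      using in_U by (auto simp: eventually_sequentially)
    then have "l \<in> {x \<in> U. norm (f x) \<le> norm (f (\<sigma> N)) + 1}"
      using Lim_in_closed_set [OF closed _ _ l] by simp
    then have lU: "l \<in> U"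
      by simp
    \<comment> \<open>On a compact ball around \<open>l\<close> inside \<open>U\<close> the scale 1
      / \<open>\<phi>\<close> is bounded by some \<open>M\<close>, and balls are convex; thus
      \<open>dst_le_segment\<close> turns Euclidean convergence into Riemannian convergence.\<close>
    obtain r where r: "0 < r" "cball l r \<subseteq> U"
      using open_U lU open_contains_cball by blast
    have "\<forall>x\<in>cball l r. \<phi> x \<noteq> 0"
      using r(2) factor_pos by (metis less_irrefl subsetD)
    then have "continuous_on (cball l r) (\<lambda>x. 1 / \<phi> x)"
      by (intro continuous_on_divide continuous_on_const continuous_on_subset [OF continuous_factor r(2)])
    then have "bounded ((\<lambda>x. 1 / \<phi> x) ` cball l r)"
      by (intro compact_imp_bounded compact_continuous_image) auto
    then obtain M where norm_le: "\<forall>y\<in>(\<lambda>x. 1 / \<phi> x) ` cball l r. norm y \<le> M"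
      unfolding bounded_iff ..
    then have M: "1 / \<phi> x \<le> M" if "x \<in> cball l r" for x
    proof -
      have "norm (1 / \<phi> x) \<le> M"
        by (rule bspec [OF norm_le imageI [OF that]])
      then show ?thesis
        unfolding real_norm_def by (rule abs_le_D1)
    qed
    have "\<forall>\<^sub>F k in sequentially. dst (\<sigma> k) l \<le> M * dist (\<sigma> k) l"
      using tendstoD [OF l r(1)]
    proof eventually_elim
      case (elim k)
      then have "closed_segment (\<sigma> k) l \<subseteq> cball l r"
        using r(1) by (intro closed_segment_subset) (simp_all add: dist_commute)
      then show ?case
        using r(2) by (intro dst_le_segment M) blast+
    qed
    moreover have "(\<lambda>k. M * dist (\<sigma> k) l) \<longlonglongrightarrow> 0"
      using l by (intro tendsto_mult_right_zero) (simp add: tendsto_dist_iff [symmetric])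
    ultimately have "(\<lambda>k. dst (\<sigma> k) l) \<longlonglongrightarrow> 0"
      by (rule tendsto_sandwich [OF always_eventually [OF allI [OF dst_nonneg]] _ tendsto_const])
    then show ?thesis
      using lU in_U by (auto simp: limitin_metric_dist_null)
  qed
  then show ?thesis
    by (simp add: complete_riemannian_def Metric_space_axioms mcomplete_def)
qed

end

section \<open>Bounds on the conformal factor\<close>

lemma psi_le:
  assumes "3 \<le> n" "0 < k" "0 < A" "0 < r"
  shows "psi n A k r \<le> k * r" "psi n A k r \<le> k / A powr (2 / (real n - 2))"
proof -
  \<comment> \<open>With this \<open>m\<close>, positive since n \<ge> 3, the outer exponent is 1 /
    m and \<open>psi\<close> becomes k r / (1 + A r^m)^(1/m).\<close>
  define m where "m = (real n - 2) / 2"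
  have m: "0 < m" "2 / (real n - 2) = 1 / m" "(real n - 2) / 2 = m"
    using assms(1) by (auto simp: m_def)
  have psi: "psi n A k r = k * r / (1 + A * r powr m) powr (1 / m)"
    by (simp add: psi_def m)
  \<comment> \<open>First bound: the denominator is at least 1.\<close>
  have ge1: "1 \<le> (1 + A * r powr m) powr (1 / m)"
    using assms m by (intro ge_one_powr_ge_zero) auto
  show "psi n A k r \<le> k * r"
    unfolding psi using assms divide_left_mono [OF ge1, of "k * r"]
      less_le_trans [OF zero_less_one ge1] by simp
  \<comment> \<open>Second bound: dropping the summand 1 leaves a denominator linear in
    \<open>r\<close>, which cancels the \<open>r\<close> of the numerator.\<close>
  have "A powr (1 / m) * r = (A * r powr m) powr (1 / m)"
    using assms m by (simp add: powr_mult powr_powr)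
  also have "\<dots> \<le> (1 + A * r powr m) powr (1 / m)"
    using assms m by (intro powr_mono2) auto
  finally have *: "A powr (1 / m) * r \<le> (1 + A * r powr m) powr (1 / m)" .
  have "psi n A k r \<le> k * r / (A powr (1 / m) * r)"
    unfolding psi using assms(2-4) less_le_trans [OF zero_less_one ge1]
    by (intro divide_left_mono [OF *] mult_pos_pos) simp_all
  then show "psi n A k r \<le> k / A powr (2 / (real n - 2))"
    using assms m by simp
qed

lemma psi_pos:
  assumes "0 < k" "0 \<le> A" "0 < r"
  shows "0 < psi n A k r"
proof -
  have "0 < 1 + A * r powr ((real n - 2) / 2)"
    using assms by (simp add: add_pos_nonneg)
  then show ?thesis
    using assms by (simp add: psi_def)
qed

lemma r_of_eq_norm: "r_of x = (norm x)\<^sup>2"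
  by (simp add: r_of_def norm_vec_def L2_set_def sum_nonneg)

section \<open>Completeness on the punctured Euclidean space\<close>

theorem corollary1p6:
  fixes A k2 :: real
  assumes "CARD('n::finite) \<ge> 3"
    and "k2 > 0"
    and "A > 0"
  shows "complete_riemannian (UNIV - {0 :: real^'n})
           (conformal_metric (\<lambda>x. psi CARD('n) A k2 (r_of x)) flat_metric)"
proof -
  let ?n = "CARD('n)"
  let ?\<phi> = "\<lambda>x :: real^'n. psi ?n A k2 (r_of x)"
  have r_pos: "0 < r_of x" if "x \<noteq> 0" for x :: "real^'n"
    using that by (simp add: r_of_eq_norm)
  interpret conformally_flat "UNIV - {0 :: real^'n}" ?\<phi> "k2 / A powr (2 / (real ?n - 2))"
  proof
    show "open (UNIV - {0 :: real^'n})"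
      by (simp add: open_Diff)
    \<comment> \<open>Removing a point keeps the space connected in dimension at least 2, which n
      \<ge> 3 provides.\<close>
    show "connected (UNIV - {0 :: real^'n})"
      using connected_punctured_universe [of "0 :: real^'n"] assms(1) by (simp add: Compl_eq_Diff_UNIV)
    have "1 + A * ((norm x)\<^sup>2) powr a > 0" for x :: "real^'n" and a
      using assms(3) by (simp add: add_pos_nonneg)
    then show "continuous_on (UNIV - {0 :: real^'n}) ?\<phi>"
      unfolding psi_def r_of_eq_norm
      by (intro continuous_intros) (auto simp: less_imp_neq [THEN not_sym])
    show "0 < ?\<phi> x" if "x \<in> UNIV - {0}" for x
      using that assms r_pos by (intro psi_pos) auto
    show "?\<phi> x \<le> k2 / A powr (2 / (real ?n - 2))" if "x \<in> UNIV - {0}" for x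
      using that assms r_pos by (intro psi_le(2)) auto
  qed
  show ?thesis
  proof (rule complete_criterion)
    \<comment> \<open>\<open>?f\<close> blows up at the origin, and its gradient has norm 1 /
      (\<open>k2\<close> |x|^2) = 1 / (\<open>k2\<close> r), which is at most 1 /
      \<open>\<psi>\<close> by \<open>psi_le(1)\<close>. At infinity \<open>?f\<close> tends to 0;
      divergence there is already excluded by the Euclidean comparison.\<close>
    let ?f = "\<lambda>x :: real^'n. 1 / (k2 * norm x)"
    let ?f' = "\<lambda>x v :: real^'n. - (inner x v / (k2 * norm x ^ 3))"
    show "(?f has_derivative ?f' x) (at x)" if "x \<in> UNIV - {0}" for x
    proof -
      have x: "norm x \<noteq> 0" "x \<noteq> 0"
        using that by auto
      have "((\<lambda>s. 1 / (k2 * s)) has_field_derivative - (1 / (k2 * (norm x)\<^sup>2))) (at (norm x))"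
        using x assms(2) by (auto intro!: derivative_eq_intros simp: power2_eq_square)
      then have "(?f has_derivative (\<lambda>v. - (1 / (k2 * (norm x)\<^sup>2)) * inner v (sgn x))) (at x)"
        using diff_chain_at [OF has_derivative_norm [OF x(2)]]
        unfolding has_field_derivative_def o_def by blast
      then show ?thesis
        by (rule has_derivative_eq_rhs)
          (simp add: fun_eq_iff sgn_div_norm inner_commute power2_eq_square power3_eq_cube divide_inverse)
    qed
    show "norm (?f' x v) \<le> norm v / ?\<phi> x" if "x \<in> UNIV - {0}" for x v
    proof -
      have x: "0 < norm x" "x \<noteq> 0"
        using that by auto
      have "norm (?f' x v) = \<bar>inner x v\<bar> / (k2 * norm x ^ 3)"
        using assms(2) by (simp add: abs_mult)
      also have "\<dots> \<le> norm x * norm v / (k2 * norm x ^ 3)"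
        using assms(2) by (intro divide_right_mono Cauchy_Schwarz_ineq2) auto
      also have "\<dots> = norm v / (k2 * r_of x)"
        using x by (simp add: r_of_eq_norm power2_eq_square power3_eq_cube)
      also have "\<dots> \<le> norm v / ?\<phi> x"
        using assms r_pos [OF x(2)] psi_le(1) [of ?n k2 A "r_of x"] psi_pos [of k2 A "r_of x" ?n]
        by (intro divide_left_mono) auto
      finally show ?thesis .
    qed
    show "closed {x \<in> UNIV - {0}. norm (?f x) \<le> R}" for R
    proof -
      \<comment> \<open>Clearing the denominator absorbs the exclusion of the origin: at x = 0 the
        right-hand condition reads 1 \<le> 0. What remains is a closed condition on the whole
        space.\<close>
      have "{x \<in> UNIV - {0}. norm (?f x) \<le> R} = {x :: real^'n. 1 \<le> R * (k2 * norm x)}"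
      proof (rule Collect_cong)
        fix x :: "real^'n"
        show "x \<in> UNIV - {0} \<and> norm (?f x) \<le> R \<longleftrightarrow> 1 \<le> R * (k2 * norm x)"
        proof (cases "x = 0")
          case False
          then have pos: "0 < k2 * norm x"
            using assms(2) by simp
          then have "norm (?f x) = ?f x"
            unfolding real_norm_def by (intro abs_of_pos divide_pos_pos) simp_all
          then show ?thesis
            using False pos by (simp only: pos_divide_le_eq) simp
        qed simp
      qed
      also have "closed \<dots>"
        by (intro closed_Collect_le continuous_intros)
      finally show ?thesis .
    qed
  qed
qed

end
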